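(* Let $G$ be a connected graph with $n$ vertices and $m$ edges. Then $tmc(G)=m+n-3$ if and only if $G$ is either $K_n-K_3$ or $K_n-P_3$.
   Context: All graphs are simple, finite and undirected. A graph is total-colored if all its edges and all its vertices are assigned colors. A path in a total-colored graph is a total monochromatic path if all its edges and all its internal vertices have the same color. A total-coloring is a TMC-coloring if any two vertices are connected by a total monochromatic path. For a connected graph $G$, $tmc(G)$ is the maximum number of colors used in a TMC-coloring of $G$. For a graph $H$, $K_n-H$ denotes the graph obtained from $K_n$ by deleting the edges of a copy of $H$ in $K_n$. $P_3$ is the path on $3$ vertices (two edges), $K_3$ the triangle. *)

theory Defs
  imports Main
begin

type_synonym 'a ugraph = "'a set \<times> 'a set set"

abbreviation verts :: "'a ugraph \<Rightarrow> 'a set" where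
  "verts G \<equiv> fst G"

abbreviation edges :: "'a ugraph \<Rightarrow> 'a set set" where
  "edges G \<equiv> snd G"

definition simple_graph :: "'a ugraph \<Rightarrow> bool" where
  "simple_graph G \<longleftrightarrow> finite (verts G) \<and> (\<forall>e \<in> edges G. e \<subseteq> verts G \<and> card e = 2)"

definition path_edges :: "'a list \<Rightarrow> 'a set set" where
  "path_edges p = {{p ! i, p ! Suc i} | i. Suc i < length p}"

definition internal_verts :: "'a list \<Rightarrow> 'a set" where
  "internal_verts p = set (butlast (tl p))"

definition is_path :: "'a ugraph \<Rightarrow> 'a \<Rightarrow> 'a list \<Rightarrow> 'a \<Rightarrow> bool" where
  "is_path G u p v \<longleftrightarrow>
     p \<noteq> [] \<and> hd p = u \<and> last p = v \<and> distinct p \<and>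
     set p \<subseteq> verts G \<and> path_edges p \<subseteq> edges G"

definition connected_graph :: "'a ugraph \<Rightarrow> bool" where
  "connected_graph G \<longleftrightarrow>
     verts G \<noteq> {} \<and> (\<forall>u \<in> verts G. \<forall>v \<in> verts G. \<exists>p. is_path G u p v)"

text \<open>
  A total-coloring is a function on the disjoint sum of vertices (\<open>Inl\<close>) and edges
  (\<open>Inr\<close>); only its values on \<open>verts G <+> edges G\<close> matter. Since graphs are
  finite, taking the natural numbers as the supply of colors is no restriction.
\<close>

type_synonym 'a total_coloring = "'a + 'a set \<Rightarrow> nat"

definition num_colors :: "'a ugraph \<Rightarrow> 'a total_coloring \<Rightarrow> nat" where
  "num_colors G c = card (c ` (verts G <+> edges G))"

definition total_monochromatic :: "'a total_coloring \<Rightarrow> 'a list \<Rightarrow> bool" where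
  "total_monochromatic c p \<longleftrightarrow>
     (\<exists>k. (\<forall>e \<in> path_edges p. c (Inr e) = k) \<and> (\<forall>x \<in> internal_verts p. c (Inl x) = k))"

definition TMC_coloring :: "'a ugraph \<Rightarrow> 'a total_coloring \<Rightarrow> bool" where
  "TMC_coloring G c \<longleftrightarrow>
     (\<forall>u \<in> verts G. \<forall>v \<in> verts G. u \<noteq> v \<longrightarrow>
        (\<exists>p. is_path G u p v \<and> total_monochromatic c p))"

definition tmc :: "'a ugraph \<Rightarrow> nat" where
  "tmc G = Max {num_colors G c | c. TMC_coloring G c}"

definition complete_graph :: "nat \<Rightarrow> nat ugraph" where
  "complete_graph n = ({..<n}, {e. e \<subseteq> {..<n} \<and> card e = 2})"

definition path_graph :: "nat \<Rightarrow> nat ugraph" where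
  "path_graph n = ({..<n}, {{i, Suc i} | i. Suc i < n})"

definition delete_edges :: "'a ugraph \<Rightarrow> 'a set set \<Rightarrow> 'a ugraph" where
  "delete_edges G F = (verts G, edges G - F)"

definition graph_iso :: "'a ugraph \<Rightarrow> 'b ugraph \<Rightarrow> bool" where
  "graph_iso G H \<longleftrightarrow>
     (\<exists>f. bij_betw f (verts G) (verts H) \<and> edges H = (\<lambda>e. f ` e) ` edges G)"

text \<open>
  The map \<open>f\<close> below picks out a copy of \<open>H\<close> in the complete graph; in particular
  \<open>H\<close> can have at most \<open>n\<close> vertices.
\<close>

definition is_complete_minus :: "'a ugraph \<Rightarrow> nat \<Rightarrow> 'b ugraph \<Rightarrow> bool" where
  "is_complete_minus G n H \<longleftrightarrow>
     (\<exists>f. inj_on f (verts H) \<and> f ` verts H \<subseteq> verts (complete_graph n) \<and>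
          graph_iso G (delete_edges (complete_graph n) ((\<lambda>e. f ` e) ` edges H)))"

text \<open>The maximum defining \<open>tmc\<close> is over a finite nonempty set.\<close>

lemma simple_graph_finite_edges:
  assumes "simple_graph G"
  shows "finite (edges G)"
proof (rule finite_subset)
  show "edges G \<subseteq> Pow (verts G)" using assms by (auto simp: simple_graph_def)
  show "finite (Pow (verts G))" using assms by (simp add: simple_graph_def)
qed

lemma finite_num_colors:
  assumes "simple_graph G"
  shows "finite {num_colors G c | c. TMC_coloring G c}"
proof (rule finite_subset)
  have fin: "finite (verts G <+> edges G)"
    using assms simple_graph_finite_edges[OF assms] by (simp add: simple_graph_def)
  show "{num_colors G c | c. TMC_coloring G c} \<subseteq> {..card (verts G <+> edges G)}"
    using card_image_le[OF fin] by (auto simp: num_colors_def)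
qed simp

lemma num_colors_nonempty:
  assumes "connected_graph G"
  shows "{num_colors G c | c. TMC_coloring G c} \<noteq> {}"
proof -
  have "TMC_coloring G (\<lambda>_. 0)"
    using assms by (auto simp: TMC_coloring_def connected_graph_def total_monochromatic_def)
  then show ?thesis by blast
qed

end

theory Submission
  imports Defs
begin

text \<open>
  Let \<open>N\<close> be the set of vertices that have a non-neighbour. A total-coloring with \<open>m + n - d\<close>
  colors repeats colors exactly \<open>d\<close> times. Connecting a non-adjacent pair takes two edges and an
  internal vertex of one color, so for \<open>d \<le> 3\<close> there is room for one color class only,
  of at most four elements, and it must be a star: all connecting paths are
  \<open>u, w, v\<close> with a common centre \<open>w\<close>. The leaves of this star contain \<open>N\<close>, so \<open>card N \<le> d\<close>.
  Conversely, if some \<open>x \<in> N\<close> is adjacent to no other vertex of \<open>N\<close>, then any neighbour \<open>w\<close> of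
  \<open>x\<close> lies outside \<open>N\<close>, is adjacent to everything, and the star from \<open>w\<close> to \<open>N\<close> yields a
  coloring with \<open>m + n - card N\<close> colors. Hence \<open>tmc G = m + n - 3\<close> means \<open>card N = 3\<close>, as
  \<open>card N \<in> {0, 2}\<close> would give more colors.
\<close>

section \<open>Non-edges, and deleting a copy of a graph from a complete graph\<close>

definition pairs :: "'a set \<Rightarrow> 'a set set" where
  "pairs V = {e. e \<subseteq> V \<and> card e = 2}"

text \<open>The edge set of the complement graph. Its union \<open>\<Union>(missing G)\<close> is
  the set N of the overview, since a vertex has a non-neighbour exactly if it lies in a missing
  pair.\<close>

definition missing :: "'a ugraph \<Rightarrow> 'a set set" where
  "missing G = pairs (verts G) - edges G"

lemma pair_in_pairs: "{u, v} \<in> pairs V \<longleftrightarrow> u \<in> V \<and> v \<in> V \<and> u \<noteq> v"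
  by (auto simp: pairs_def card_insert_if)

lemma pairsE:
  assumes "e \<in> pairs V"
  obtains u v where "e = {u, v}" "u \<noteq> v" "u \<in> V" "v \<in> V"
  using assms by (auto simp: pairs_def card_2_iff)

lemma missingE:
  assumes "e \<in> missing G"
  obtains u v where "e = {u, v}" "u \<noteq> v" "{u, v} \<in> missing G" "u \<in> verts G" "v \<in> verts G"
proof -
  have "e \<in> pairs (verts G)" using assms by (simp add: missing_def)
  then show ?thesis using that assms by (elim pairsE) simp
qed

lemma edges_eq_diff_missing:
  assumes "simple_graph G"
  shows "edges G = pairs (verts G) - missing G"
  using assms by (auto simp: simple_graph_def pairs_def missing_def)

lemma image_pairs:
  assumes "bij_betw f V W"
  shows "image f ` pairs V = pairs W"
proof (intro equalityI subsetI)
  fix e assume "e \<in> image f ` pairs V"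
  then obtain d where d: "d \<in> pairs V" "e = f ` d" by blast
  then have "inj_on f d"
    using assms by (auto simp: pairs_def bij_betw_def intro: inj_on_subset)
  then show "e \<in> pairs W"
    using d assms by (auto simp: pairs_def bij_betw_def card_image)
next
  fix e assume e: "e \<in> pairs W"
  then have "e \<subseteq> f ` V" using assms by (simp add: pairs_def bij_betw_def)
  then obtain d where d: "d \<subseteq> V" "e = f ` d" by (auto simp: subset_image_iff)
  have "inj_on f d"
    using assms d(1) by (auto simp: bij_betw_def intro: inj_on_subset)
  then have "d \<in> pairs V" using d e by (auto simp: pairs_def card_image)
  then show "e \<in> image f ` pairs V" using d by blast
qed

text \<open>Taking images under \<open>f\<close> is injective on the subsets of
  \<open>verts G\<close>, so it commutes with set difference and can be cancelled on both sides.
  This moves a deleted copy between \<open>W\<close> and the vertex set of \<open>G\<close>.\<close>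

lemma edges_iso_complete_minus_iff:
  assumes G: "simple_graph G" and bij: "bij_betw f (verts G) W"
    and g: "\<And>e. e \<in> F \<Longrightarrow> g ` e \<subseteq> verts G"
  shows "pairs W - image (f \<circ> g) ` F = image f ` edges G \<longleftrightarrow>
    edges G = pairs (verts G) - image g ` F"
proof -
  have inj: "inj_on (image f) (Pow (verts G))"
    using bij by (simp add: bij_betw_def inj_on_image_Pow)
  have sub: "edges G \<subseteq> Pow (verts G)" "pairs (verts G) \<subseteq> Pow (verts G)"
    "image g ` F \<subseteq> Pow (verts G)"
    using G g by (auto simp: simple_graph_def pairs_def)
  have "pairs W - image (f \<circ> g) ` F = image f ` pairs (verts G) - image f ` image g ` F"
    using image_pairs[OF bij] by (simp add: image_image image_comp o_def)
  also have "\<dots> = image f ` (pairs (verts G) - image g ` F)"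
    using inj_on_image_set_diff[OF inj subset_trans[OF Diff_subset sub(2)] sub(3)] by simp
  finally have *: "pairs W - image (f \<circ> g) ` F = image f ` (pairs (verts G) - image g ` F)" .
  show ?thesis
    unfolding * inj_on_image_eq_iff[OF inj subset_trans[OF Diff_subset sub(2)] sub(1)]
    by (rule eq_commute)
qed

text \<open>The definition places the copy of \<open>H\<close> in \<open>{..<n}\<close>.
  Transporting it along the isomorphism places it in \<open>G\<close> itself, so that numbered
  vertices disappear and only the shape of the complement of \<open>G\<close> matters.\<close>

lemma is_complete_minus_iff:
  assumes G: "simple_graph G" and n: "card (verts G) = n" and H: "edges H \<subseteq> pairs (verts H)"
  shows "is_complete_minus G n H \<longleftrightarrow>
    (\<exists>g. inj_on g (verts H) \<and> g ` verts H \<subseteq> verts G \<and> missing G = image g ` edges H)"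
    (is "_ \<longleftrightarrow> ?R")
proof -
  have missing_iff: "edges G = pairs (verts G) - image g ` edges H \<longleftrightarrow>
      missing G = image g ` edges H" if g: "inj_on g (verts H)" "g ` verts H \<subseteq> verts G" for g
  proof -
    have "g ` e \<in> pairs (verts G)" if e: "e \<in> edges H" for e
    proof -
      obtain x y where "e = {x, y}" "x \<noteq> y" "x \<in> verts H" "y \<in> verts H"
        using e H by (blast elim: pairsE)
      then show ?thesis using g by (auto simp: pair_in_pairs inj_on_def)
    qed
    then show ?thesis using edges_eq_diff_missing[OF G] by (auto simp: missing_def)
  qed
  have H': "e \<subseteq> verts H" if "e \<in> edges H" for e using that H by (auto simp: pairs_def)
  show ?thesis
  proof
    assume "is_complete_minus G n H"
    then obtain f h where f: "inj_on f (verts H)" "f ` verts H \<subseteq> {..<n}"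
      and h: "bij_betw h (verts G) {..<n}"
      and E: "pairs {..<n} - image f ` edges H = image h ` edges G"
      by (auto simp: is_complete_minus_def graph_iso_def delete_edges_def complete_graph_def pairs_def)
    \<comment> \<open>The copy of \<open>H\<close> is pulled back along \<open>h\<close>. As
      \<open>h \<circ> g\<close> agrees with \<open>f\<close> on \<open>verts H\<close>, both delete
      the same edges.\<close>
    define g where "g = inv_into (verts G) h \<circ> f"
    have hg: "h (g x) = f x" and gV: "g x \<in> verts G" if "x \<in> verts H" for x
      using that f h unfolding g_def bij_betw_def
      by (auto simp: f_inv_into_f inv_into_into image_subset_iff)
    have inj: "inj_on g (verts H)"
    proof (rule inj_onI)
      fix x y assume "x \<in> verts H" "y \<in> verts H" "g x = g y"
      then show "x = y" using hg[of x] hg[of y] inj_onD[OF f(1)] by simp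
    qed
    have im: "image (h \<circ> g) ` edges H = image f ` edges H"
    proof (rule image_cong[OF refl])
      fix e assume "e \<in> edges H"
      then show "(h \<circ> g) ` e = f ` e" using hg H' by (intro image_cong) auto
    qed
    have "edges G = pairs (verts G) - image g ` edges H"
    proof (rule iffD1[OF edges_iso_complete_minus_iff[OF G h]])
      show "g ` e \<subseteq> verts G" if "e \<in> edges H" for e using H'[OF that] gV by blast
      show "pairs {..<n} - image (h \<circ> g) ` edges H = image h ` edges G" unfolding im by (rule E)
    qed
    moreover have "g ` verts H \<subseteq> verts G" using gV by blast
    ultimately show ?R using missing_iff[OF inj] inj by (intro exI[of _ g]) simp
  next
    assume ?R
    then obtain g where g: "inj_on g (verts H)" "g ` verts H \<subseteq> verts G"
      and M: "missing G = image g ` edges H" by metis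
    have E: "edges G = pairs (verts G) - image g ` edges H" using missing_iff[OF g] M by simp
    have "finite (verts G)" using G by (simp add: simple_graph_def)
    then obtain h where h: "bij_betw h (verts G) {..<n}"
      using n by (metis ex_bij_betw_finite_nat lessThan_atLeast0)
    have "pairs {..<n} - image (h \<circ> g) ` edges H = image h ` edges G"
    proof (rule iffD2[OF edges_iso_complete_minus_iff[OF G h]])
      show "g ` e \<subseteq> verts G" if "e \<in> edges H" for e using H'[OF that] g(2) by blast
    qed (rule E)
    moreover have "inj_on (h \<circ> g) (verts H)"
      using g h by (metis bij_betw_def comp_inj_on inj_on_subset)
    moreover have "(h \<circ> g) ` verts H \<subseteq> {..<n}"
      using g h by (auto simp: bij_betw_def)
    ultimately show "is_complete_minus G n H"
      using h unfolding is_complete_minus_def graph_iso_def delete_edges_def complete_graph_def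
        pairs_def by (intro exI[of _ "h \<circ> g"]) auto
  qed
qed

section \<open>The two graphs on three vertices\<close>

text \<open>Trades an embedding of a three-vertex graph for its three images. The predicate
  \<open>P\<close> is left open so that one lemma serves the path and the triangle.\<close>

lemma ex_inj_on_3_iff:
  "(\<exists>g. inj_on g {0, 1, 2 :: nat} \<and> g ` {0, 1, 2} \<subseteq> V \<and> P (g 0) (g 1) (g 2)) \<longleftrightarrow>
    (\<exists>a b c. distinct [a, b, c] \<and> {a, b, c} \<subseteq> V \<and> P a b c)" (is "?L \<longleftrightarrow> ?R")
proof
  assume ?L
  then show ?R
  proof (elim exE)
    fix g assume "inj_on g {0, 1, 2 :: nat} \<and> g ` {0, 1, 2} \<subseteq> V \<and> P (g 0) (g 1) (g 2)"
    then show ?R by (intro exI[of _ "g 0"] exI[of _ "g 1"] exI[of _ "g 2"]) (simp add: inj_on_def)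
  qed
next
  assume ?R
  then show ?L
  proof (elim exE)
    fix a b c
    assume *: "distinct [a, b, c] \<and> {a, b, c} \<subseteq> V \<and> P a b c"
    define g where "g = (\<lambda>i::nat. if i = 0 then a else if i = 1 then b else c)"
    have "inj_on g {0, 1, 2} \<and> g ` {0, 1, 2} \<subseteq> V \<and> P (g 0) (g 1) (g 2)"
      using * by (auto simp: g_def inj_on_def)
    then show ?L by (intro exI[of _ g])
  qed
qed

lemma lessThan_3: "{..<3} = {0, 1, 2 :: nat}"
  by auto

lemma path_edges_singleton: "path_edges [x] = {}"
  by (simp add: path_edges_def)

lemma path_edges_Cons_Cons: "path_edges (x # y # p) = insert {x, y} (path_edges (y # p))"
proof (intro equalityI subsetI)
  fix e assume "e \<in> path_edges (x # y # p)"
  then obtain i where "e = {(x # y # p) ! i, (x # y # p) ! Suc i}" "Suc i < length (x # y # p)"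
    unfolding path_edges_def by blast
  then show "e \<in> insert {x, y} (path_edges (y # p))"
    by (cases i) (auto simp: path_edges_def)
next
  fix e assume "e \<in> insert {x, y} (path_edges (y # p))"
  then consider "e = {x, y}"
    | i where "e = {(y # p) ! i, (y # p) ! Suc i}" "Suc i < length (y # p)"
    unfolding path_edges_def by blast
  then show "e \<in> path_edges (x # y # p)"
  proof cases
    case 1
    then show ?thesis unfolding path_edges_def by (intro CollectI exI[of _ 0]) simp
  next
    case 2
    then show ?thesis unfolding path_edges_def by (intro CollectI exI[of _ "Suc i"]) simp
  qed
qed

lemmas path_edges_simps = path_edges_singleton path_edges_Cons_Cons

lemma edges_path_graph_3: "edges (path_graph 3) = {{0, 1}, {1, 2}}"
proof -
  have "Suc i < 3 \<longleftrightarrow> i = 0 \<or> i = 1" for i by auto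
  then show ?thesis by (auto simp: path_graph_def numeral_2_eq_2)
qed

lemma edges_complete_graph_3: "edges (complete_graph 3) = {{0, 1}, {1, 2}, {0, 2}}"
proof -
  have "e \<in> pairs {..<3} \<longleftrightarrow> e \<in> {{0, 1}, {1, 2}, {0, 2}}" for e :: "nat set"
    by (auto simp: lessThan_3 pair_in_pairs insert_commute elim!: pairsE)
  then have "pairs {..<3} = {{0, 1}, {1, 2}, {0, 2 :: nat}}" by (rule set_eqI)
  then show ?thesis by (simp add: complete_graph_def pairs_def)
qed

lemma is_complete_minus_path_graph_3_iff:
  assumes "simple_graph G" "card (verts G) = n"
  shows "is_complete_minus G n (path_graph 3) \<longleftrightarrow>
    (\<exists>a b c. distinct [a, b, c] \<and> {a, b, c} \<subseteq> verts G \<and> missing G = {{a, b}, {b, c}})"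
proof -
  have V: "verts (path_graph 3) = {0, 1, 2}" by (simp add: path_graph_def lessThan_3)
  have E: "edges (path_graph 3) \<subseteq> pairs (verts (path_graph 3))"
    unfolding V edges_path_graph_3 by (simp add: pair_in_pairs)
  show ?thesis
    unfolding is_complete_minus_iff[OF assms E] V edges_path_graph_3
    using ex_inj_on_3_iff[of "verts G" "\<lambda>a b c. missing G = {{a, b}, {b, c}}"] by simp
qed

lemma is_complete_minus_complete_graph_3_iff:
  assumes "simple_graph G" "card (verts G) = n"
  shows "is_complete_minus G n (complete_graph 3) \<longleftrightarrow>
    (\<exists>a b c. distinct [a, b, c] \<and> {a, b, c} \<subseteq> verts G \<and> missing G = {{a, b}, {b, c}, {a, c}})"
proof -
  have V: "verts (complete_graph 3) = {0, 1, 2}" by (simp add: complete_graph_def lessThan_3)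
  have E: "edges (complete_graph 3) \<subseteq> pairs (verts (complete_graph 3))"
    unfolding V edges_complete_graph_3 by (simp add: pair_in_pairs)
  show ?thesis
    unfolding is_complete_minus_iff[OF assms E] V edges_complete_graph_3
    using ex_inj_on_3_iff[of "verts G" "\<lambda>a b c. missing G = {{a, b}, {b, c}, {a, c}}"] by simp
qed

section \<open>Lower bounds on tmc from star colorings\<close>

lemma finite_elements:
  assumes "simple_graph G"
  shows "finite (verts G <+> edges G)"
  using assms simple_graph_finite_edges by (simp add: simple_graph_def)

lemma card_elements:
  assumes "simple_graph G"
  shows "card (verts G <+> edges G) = card (verts G) + card (edges G)"
  using assms simple_graph_finite_edges[OF assms] by (simp add: card_Plus simple_graph_def)

lemma num_colors_le_tmc:
  assumes "simple_graph G" "TMC_coloring G c"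
  shows "num_colors G c \<le> tmc G"
  unfolding tmc_def using assms(2) by (intro Max_ge finite_num_colors assms(1)) blast

lemma finite_Union_missing:
  assumes "simple_graph G"
  shows "finite (\<Union>(missing G))"
  using assms by (auto simp: simple_graph_def missing_def pairs_def intro: rev_finite_subset)

text \<open>An edge on its own is a total monochromatic path under any coloring. A non-adjacent pair
  consists of two leaves in \<open>S\<close>, and the path between them through the centre
  \<open>w\<close> has the color of the star.\<close>

lemma TMC_coloring_star:
  assumes w: "w \<in> verts G" "w \<notin> S"
    and star: "\<And>s. s \<in> S \<Longrightarrow> {s, w} \<in> edges G" and sub: "\<Union>(missing G) \<subseteq> S"
    and c: "\<And>s. s \<in> S \<Longrightarrow> c (Inr {s, w}) = c (Inl w)"
  shows "TMC_coloring G c"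
  unfolding TMC_coloring_def
proof (intro ballI impI)
  fix u v assume uv: "u \<in> verts G" "v \<in> verts G" "u \<noteq> v"
  show "\<exists>p. is_path G u p v \<and> total_monochromatic c p"
  proof (cases "{u, v} \<in> edges G")
    case True
    then have "is_path G u [u, v] v \<and> total_monochromatic c [u, v]"
      using uv
      by (simp add: is_path_def total_monochromatic_def internal_verts_def path_edges_simps)
    then show ?thesis ..
  next
    case False
    then have "{u, v} \<in> missing G" using uv by (simp add: missing_def pair_in_pairs)
    then have uvS: "u \<in> S" "v \<in> S" using sub by auto
    have "path_edges [u, w, v] = {{u, w}, {v, w}}"
      by (simp add: path_edges_simps insert_commute[of w v])
    moreover have "u \<noteq> w" "v \<noteq> w" using uvS w(2) by auto
    ultimately have "is_path G u [u, w, v] v \<and> total_monochromatic c [u, w, v]"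
      using uv w uvS star c by (simp add: is_path_def total_monochromatic_def internal_verts_def)
    then show ?thesis ..
  qed
qed

text \<open>The star has at most \<open>card S + 1\<close> elements, counting its centre. Giving it
  one color and everything else a color of its own loses at most \<open>card S\<close>
  colors.\<close>

lemma tmc_ge_star:
  assumes G: "simple_graph G" and w: "w \<in> verts G" and S: "finite S" "w \<notin> S"
    and star: "\<And>s. s \<in> S \<Longrightarrow> {s, w} \<in> edges G" and sub: "\<Union>(missing G) \<subseteq> S"
  shows "card (verts G) + card (edges G) \<le> tmc G + card S"
proof -
  let ?T = "verts G <+> edges G"
  define A :: "('a + 'a set) set" where "A = insert (Inl w) (Inr ` (\<lambda>s. {s, w}) ` S)"
  have fin: "finite ?T"
    by (rule finite_elements[OF G])
  then obtain h :: "'a + 'a set \<Rightarrow> nat" where h: "inj_on h ?T"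
    using finite_imp_inj_to_nat_seg[OF fin] by auto
  \<comment> \<open>Color 0 is reserved for the star; \<open>Suc\<close> keeps the other colors away
    from it.\<close>
  define c where "c = (\<lambda>x. if x \<in> A then 0 else Suc (h x))"
  have AT: "A \<subseteq> ?T" using w star by (auto simp: A_def)
  have "TMC_coloring G c"
    by (rule TMC_coloring_star[OF w S(2) star sub]) (simp_all add: c_def A_def)
  then have le: "num_colors G c \<le> tmc G" by (rule num_colors_le_tmc[OF G])
  \<comment> \<open>The centre represents the whole star, so that all colors are counted on a set
    where \<open>c\<close> is injective.\<close>
  have "inj_on c (insert (Inl w) (?T - A))"
    using h by (auto simp: inj_on_def c_def A_def)
  then have "card (insert (Inl w) (?T - A)) \<le> num_colors G c"
    unfolding num_colors_def using fin w by (intro card_inj_on_le[of c]) auto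
  moreover have "card (insert (Inl w) (?T - A)) = Suc (card ?T - card A)"
    using fin card_Diff_subset[OF finite_subset[OF AT fin] AT]
    by (subst card_insert_disjoint) (simp_all add: A_def)
  moreover have "card A \<le> Suc (card S)"
    using S card_image_le[of S "\<lambda>s. Inr {s, w} :: 'a + 'a set"]
    unfolding A_def image_image by (auto simp: card_insert_if)
  ultimately show ?thesis using le card_elements[OF G] by linarith
qed

lemma tmc_ge_missing:
  assumes G: "simple_graph G" and con: "connected_graph G"
    and x: "{x, y} \<in> missing G" "\<And>z. z \<in> \<Union>(missing G) \<Longrightarrow> z \<noteq> x \<Longrightarrow> {x, z} \<in> missing G"
  shows "card (verts G) + card (edges G) \<le> tmc G + card (\<Union>(missing G))"
proof -
  have "x \<in> verts G" "y \<in> verts G" "x \<noteq> y" using x(1) by (auto simp: missing_def pair_in_pairs)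
  then obtain p where p: "is_path G x p y" using con by (auto simp: connected_graph_def)
  \<comment> \<open>Connectedness provides a neighbour of \<open>x\<close>: the second vertex of a
    path to \<open>y\<close>. It will be the centre of the star.\<close>
  then obtain w r where pw: "p = x # w # r"
    using \<open>x \<noteq> y\<close> by (cases p; cases "tl p") (auto simp: is_path_def)
  then have w: "w \<in> verts G" "w \<noteq> x" "{x, w} \<in> edges G"
    using p by (auto simp: is_path_def path_edges_simps)
  then have "w \<notin> \<Union>(missing G)" using x(2) by (auto simp: missing_def)
  moreover have "{s, w} \<in> edges G" if "s \<in> \<Union>(missing G)" for s
  proof (rule ccontr)
    assume "{s, w} \<notin> edges G"
    moreover have "s \<in> verts G" using that by (auto simp: missing_def pairs_def)
    ultimately have "{s, w} \<in> missing G"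
      using that w \<open>w \<notin> _\<close> by (auto simp: missing_def pair_in_pairs)
    then show False using \<open>w \<notin> _\<close> by blast
  qed
  ultimately show ?thesis
    using tmc_ge_star[OF G w(1) finite_Union_missing[OF G]] by blast
qed

section \<open>Upper bounds on tmc by counting repeated colors\<close>

lemma ex_optimal_TMC_coloring:
  assumes "simple_graph G" "connected_graph G"
  obtains c where "TMC_coloring G c" "num_colors G c = tmc G"
proof -
  have "tmc G \<in> {num_colors G c | c. TMC_coloring G c}"
    unfolding tmc_def using assms by (intro Max_in finite_num_colors num_colors_nonempty)
  then show ?thesis using that by auto
qed

lemma tmc_le_card_elements:
  assumes "simple_graph G" "connected_graph G"
  shows "tmc G \<le> card (verts G) + card (edges G)"
proof -
  obtain c where "num_colors G c = tmc G" using ex_optimal_TMC_coloring[OF assms] .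
  moreover have "finite (verts G <+> edges G)"
    using assms(1) by (rule finite_elements)
  ultimately show ?thesis
    using card_image_le card_elements[OF assms(1)] by (metis num_colors_def)
qed

text \<open>A set \<open>A\<close> that shows at most \<open>j\<close> colors accounts for at least
  \<open>card A - j\<close> repetitions, whatever happens outside it.\<close>

lemma card_image_add_card_le:
  assumes "finite E" "A \<subseteq> E" "card (c ` A) \<le> j"
  shows "card (c ` E) + card A \<le> card E + j"
proof -
  have "card (c ` E) \<le> card (c ` A) + card (c ` (E - A))"
    using assms(2) by (metis Un_Diff_cancel card_Un_le image_Un sup.absorb2)
  also have "\<dots> \<le> j + card (E - A)"
    using assms by (intro add_mono card_image_le) auto
  finally show ?thesis
    using assms card_Diff_subset[of A E] card_mono[of E A] finite_subset[of A E] by linarith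
qed

text \<open>At most three repetitions are available. A path with two or more internal vertices has
  at least three edges, so it would put five elements into one color and cost four repetitions.
  Hence a connecting path has exactly one internal vertex.\<close>

lemma missing_pair_connected:
  assumes G: "simple_graph G" and c: "TMC_coloring G c"
    and few: "card (verts G) + card (edges G) \<le> num_colors G c + 3"
    and uv: "{u, v} \<in> missing G"
  obtains w where "w \<in> verts G" "{u, w} \<in> edges G" "{v, w} \<in> edges G" "u \<noteq> w" "v \<noteq> w"
    "c (Inr {u, w}) = c (Inl w)" "c (Inr {v, w}) = c (Inl w)"
proof -
  have "u \<in> verts G" "v \<in> verts G" "u \<noteq> v" and nE: "{u, v} \<notin> edges G"
    using uv by (auto simp: missing_def pair_in_pairs)
  then obtain p where p: "is_path G u p v" and "total_monochromatic c p"
    using c by (auto simp: TMC_coloring_def)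
  then obtain k where kE: "\<forall>e \<in> path_edges p. c (Inr e) = k"
    and kV: "\<forall>x \<in> internal_verts p. c (Inl x) = k"
    unfolding total_monochromatic_def by blast
  have pE: "path_edges p \<subseteq> edges G"
    and pV: "set p \<subseteq> verts G" and dis: "distinct p" and ends: "p \<noteq> []" "hd p = u" "last p = v"
    using p unfolding is_path_def by blast+
  obtain w r where p3: "p = u # w # r" "r \<noteq> []"
    using ends nE \<open>u \<noteq> v\<close> pE
    by (cases p; cases "tl p") (auto simp: path_edges_simps split: if_splits)
  then obtain x s where p4: "p = u # w # x # s" by (cases r) auto
  have "s = []"
  proof (rule ccontr)
    assume "s \<noteq> []"
    then obtain y t where p5: "p = u # w # x # y # t" using p4 by (cases s) auto
    let ?A = "{Inl w, Inl x, Inr {u, w}, Inr {w, x}, Inr {x, y}}"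
    have "c ` ?A \<subseteq> {k}"
      using kE kV p5 by (simp add: internal_verts_def path_edges_simps)
    then have "card (c ` ?A) \<le> 1" using card_mono[of "{k}"] by simp
    moreover have "?A \<subseteq> verts G <+> edges G"
      using pE pV p5 by (simp add: path_edges_simps InlI InrI)
    moreover have "finite (verts G <+> edges G)"
      by (rule finite_elements[OF G])
    ultimately have "num_colors G c + card ?A \<le> card (verts G) + card (edges G) + 1"
      using card_image_add_card_le card_elements[OF G] by (metis num_colors_def)
    moreover have "card ?A = 5"
      using dis p5 by (auto simp: card_insert_if doubleton_eq_iff)
    ultimately show False using few by linarith
  qed
  then have pw: "p = [u, w, v]" using p4 ends by auto
  show ?thesis
  proof (rule that[of w])
    show "w \<in> verts G" "{u, w} \<in> edges G" "{v, w} \<in> edges G" "u \<noteq> w" "v \<noteq> w"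
      using pw pV pE dis by (auto simp: insert_commute path_edges_simps)
    show "c (Inr {u, w}) = c (Inl w)" "c (Inr {v, w}) = c (Inl w)"
      using pw kE kV by (auto simp: insert_commute internal_verts_def path_edges_simps)
  qed
qed

lemma card_Union_missing_le:
  assumes G: "simple_graph G" and con: "connected_graph G"
    and d: "tmc G + d = card (verts G) + card (edges G)" "d \<le> 3"
  shows "card (\<Union>(missing G)) \<le> d"
proof (cases "missing G = {}")
  case False
  obtain c where c: "TMC_coloring G c" and nc: "num_colors G c = tmc G"
    using ex_optimal_TMC_coloring[OF G con] .
  have fin: "finite (verts G <+> edges G)"
    by (rule finite_elements[OF G])
  \<comment> \<open>The budget used in every count below: elements sharing \<open>j\<close> colors
    number at most \<open>d + j\<close>.\<close>
  have gap: "card A \<le> d + j" if "A \<subseteq> verts G <+> edges G" "c ` A \<subseteq> K" "finite K" "card K \<le> j"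
    for A j K
  proof -
    have "card (c ` A) \<le> j" using that card_mono by (metis le_trans)
    then show ?thesis
      using card_image_add_card_le[OF fin that(1), of c j] nc d card_elements[OF G]
      by (simp add: num_colors_def)
  qed
  have few: "card (verts G) + card (edges G) \<le> num_colors G c + 3" using nc d by linarith
  note connected = missing_pair_connected[OF G c few]
  obtain e0 where e0: "e0 \<in> missing G" using False by blast
  then obtain u0 v0 where uv0: "e0 = {u0, v0}" "u0 \<noteq> v0" by (blast elim: missingE)
  obtain w0 where w0: "w0 \<in> verts G" "{u0, w0} \<in> edges G" "{v0, w0} \<in> edges G" "u0 \<noteq> w0" "v0 \<noteq> w0"
    "c (Inr {u0, w0}) = c (Inl w0)" "c (Inr {v0, w0}) = c (Inl w0)"
    using connected[of u0 v0] e0 uv0 by blast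
  \<comment> \<open>The connecting path of one fixed missing pair determines the centre
    \<open>w0\<close>; \<open>S\<close> collects all leaves of the star in its color. Every other
    missing pair is now shown to use the same star.\<close>
  define S where "S = {s. {s, w0} \<in> edges G \<and> c (Inr {s, w0}) = c (Inl w0)}"
  have "e \<subseteq> S" if e: "e \<in> missing G" for e
  proof -
    obtain u v where uv: "e = {u, v}" "u \<noteq> v" using e by (blast elim: missingE)
    obtain w where w: "w \<in> verts G" "{u, w} \<in> edges G" "{v, w} \<in> edges G" "u \<noteq> w" "v \<noteq> w"
      "c (Inr {u, w}) = c (Inl w)" "c (Inr {v, w}) = c (Inl w)"
      using connected[of u v] e uv by blast
    have same: "c (Inl w) = c (Inl w0)"
    proof (rule ccontr)
      assume diff: "c (Inl w) \<noteq> c (Inl w0)"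
      \<comment> \<open>Two colors on two disjoint triples, each made of a centre and two edges,
        cost four repetitions.\<close>
      let ?A = "{Inl w0, Inl w, Inr {u0, w0}, Inr {v0, w0}, Inr {u, w}, Inr {v, w}}"
      have ne: "w0 \<noteq> w" "{u0, w0} \<noteq> {v0, w0}" "{u, w} \<noteq> {v, w}"
        using diff uv0 uv by (auto simp: doubleton_eq_iff)
      have ne': "{u0, w0} \<noteq> {u, w}" "{u0, w0} \<noteq> {v, w}" "{v0, w0} \<noteq> {u, w}" "{v0, w0} \<noteq> {v, w}"
        using diff w0(6,7) w(6,7) by metis+
      have "card ?A = 6"
        using ne ne' by simp
      moreover have "card ?A \<le> d + 2"
        by (rule gap[of _ "{c (Inl w0), c (Inl w)}"]) (use w0 w in \<open>auto simp: card_insert_if\<close>)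
      ultimately show False using d by linarith
    qed
    have "w = w0"
    proof (rule ccontr)
      assume diff: "w \<noteq> w0"
      \<comment> \<open>The second path adds an edge outside the first. If \<open>{u, w}\<close> is
        an edge of the first path, then \<open>u = w0\<close> because \<open>w \<noteq> w0\<close>;
        so \<open>v \<noteq> w0\<close>, and \<open>{v, w}\<close> does not meet \<open>w0\<close>.
        With both centres this gives five elements of one color, again four repetitions.\<close>
      obtain f where f: "f = {u, w} \<or> f = {v, w}" "f \<noteq> {u0, w0}" "f \<noteq> {v0, w0}"
      proof (cases "{u, w} = {u0, w0} \<or> {u, w} = {v0, w0}")
        case True
        then show ?thesis
          using that[of "{v, w}"] diff uv(2) w(4,5) by (auto simp: doubleton_eq_iff)
      qed (use that in auto)
      let ?A = "{Inl w0, Inl w, Inr f, Inr {u0, w0}, Inr {v0, w0}}"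
      have "{u0, w0} \<noteq> {v0, w0}" using uv0 by (auto simp: doubleton_eq_iff)
      then have "card ?A = 5" using f diff by simp
      moreover have "card ?A \<le> d + 1"
        by (rule gap[of _ "{c (Inl w0)}"]) (use w0 w f same in auto)
      ultimately show False using d by linarith
    qed
    then show ?thesis using w uv by (auto simp: S_def)
  qed
  then have sub: "\<Union>(missing G) \<subseteq> S" by blast
  \<comment> \<open>The full star has \<open>card S + 1\<close> elements of a single color, whence
    \<open>card S \<le> d\<close>.\<close>
  let ?A = "insert (Inl w0) (Inr ` (\<lambda>s. {s, w0}) ` S)"
  have "S \<subseteq> verts G" using G by (auto simp: S_def simple_graph_def)
  then have finS: "finite S" using G finite_subset by (auto simp: simple_graph_def)
  have "inj_on (\<lambda>s. Inr {s, w0} :: 'a + 'a set) S" by (auto simp: inj_on_def doubleton_eq_iff)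
  then have "card (Inr ` (\<lambda>s. {s, w0}) ` S :: ('a + 'a set) set) = card S"
    unfolding image_image by (rule card_image)
  then have "card ?A = Suc (card S)"
    using finS by (subst card_insert_disjoint) auto
  moreover have "card ?A \<le> d + 1"
    by (rule gap[of _ "{c (Inl w0)}"]) (use w0 in \<open>auto simp: S_def\<close>)
  ultimately show ?thesis using card_mono[OF finS sub] by linarith
qed simp

section \<open>Graphs with exactly three repetitions\<close>

lemma subset_triple_cases:
  assumes "M \<subseteq> {x, y, z}" "x \<in> M" "y \<in> M \<or> z \<in> M"
  shows "M = {x, y, z} \<or> M = {x, y} \<or> M = {x, z}"
  using assms by (cases "y \<in> M"; cases "z \<in> M") blast+

lemma tmc_add_3_eq_iff:
  assumes G: "simple_graph G" and con: "connected_graph G"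
  shows "tmc G + 3 = card (verts G) + card (edges G) \<longleftrightarrow>
    (\<exists>a b c. distinct [a, b, c] \<and> {a, b, c} \<subseteq> verts G \<and>
      (missing G = {{a, b}, {b, c}, {a, c}} \<or> missing G = {{a, b}, {b, c}}))" (is "?L \<longleftrightarrow> ?R")
proof
  assume L: ?L
  let ?N = "\<Union>(missing G)"
  have pairs: "missing G \<subseteq> pairs ?N"
    by (auto simp: missing_def pairs_def)
  obtain w where w: "w \<in> verts G" using con by (auto simp: connected_graph_def)
  have "missing G \<noteq> {}"
  proof
    assume "missing G = {}"
    \<comment> \<open>In a complete graph a star without leaves suffices: all elements may receive
      different colors.\<close>
    then have "card (verts G) + card (edges G) \<le> tmc G + card ({} :: 'a set)"
      by (intro tmc_ge_star[OF G w]) simp_all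
    then show False using L assms by simp
  qed
  then obtain a b where ab: "{a, b} \<in> missing G" "a \<noteq> b"
    by (blast elim: missingE)
  have "?N \<noteq> {a, b}"
  proof
    assume N: "?N = {a, b}"
    \<comment> \<open>With a single missing pair, \<open>a\<close> is non-adjacent to the only other
      vertex of \<open>?N\<close>, so two repetitions are enough.\<close>
    have "card (verts G) + card (edges G) \<le> tmc G + card ?N"
      using tmc_ge_missing[OF G con ab(1)] ab(1) assms unfolding N by blast
    then show False using N L ab by simp
  qed
  then obtain c where c: "c \<in> ?N" "c \<noteq> a" "c \<noteq> b" using ab by blast
  have "card ?N \<le> 3" using card_Union_missing_le[OF G con] L assms by simp
  moreover have "{a, b, c} \<subseteq> ?N" using ab(1) c(1) by blast
  moreover have "card {a, b, c} = 3" using ab(2) c(2,3) by simp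
  ultimately have N: "?N = {a, b, c}"
    using card_seteq[OF finite_Union_missing[OF G]] by metis
  have V: "{a, b, c} \<subseteq> verts G" unfolding N[symmetric] by (auto simp: missing_def pairs_def)
  have "pairs {a, b, c} = {{a, b}, {b, c}, {a, c}}"
    using ab c by (auto simp: pair_in_pairs insert_commute elim!: pairsE)
  then have sub: "missing G \<subseteq> {{a, b}, {b, c}, {a, c}}" using pairs N by simp
  then have "{b, c} \<in> missing G \<or> {a, c} \<in> missing G"
    using c by blast
  then have "missing G = {{a, b}, {b, c}, {a, c}} \<or> missing G = {{a, b}, {b, c}} \<or>
      missing G = {{a, b}, {a, c}}"
    by (rule subset_triple_cases[OF sub ab(1)])
  then consider "missing G = {{a, b}, {b, c}, {a, c}}" | "missing G = {{a, b}, {b, c}}"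
    | "missing G = {{a, b}, {a, c}}"
    by (elim disjE)
  then show ?R
  proof cases
    case 1
    then show ?thesis using ab c V by (intro exI[of _ a] exI[of _ b] exI[of _ c]) simp
  next
    case 2
    then show ?thesis using ab c V by (intro exI[of _ a] exI[of _ b] exI[of _ c]) simp
  next
    case 3
    \<comment> \<open>Here \<open>a\<close> is the middle vertex of the missing path, so
      \<open>a\<close> and \<open>b\<close> exchange roles.\<close>
    then have "missing G = {{b, a}, {a, c}}" by (simp only: insert_commute[of b a "{}"])
    then show ?thesis using ab c V by (intro exI[of _ b] exI[of _ a] exI[of _ c]) simp
  qed
next
  assume ?R
  then obtain a b c where abc: "distinct [a, b, c]"
    and M: "missing G = {{a, b}, {b, c}, {a, c}} \<or> missing G = {{a, b}, {b, c}}" by meson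
  from M have N: "\<Union>(missing G) = {a, b, c}"
    by (elim disjE) (simp_all add: insert_commute)
  then have N3: "card (\<Union>(missing G)) = 3" using abc by simp
  \<comment> \<open>In both cases \<open>b\<close> is non-adjacent to \<open>a\<close> and to
    \<open>c\<close>, so it can serve as the vertex whose neighbours are adjacent to
    everything.\<close>
  have "card (verts G) + card (edges G) \<le> tmc G + card (\<Union>(missing G))"
    using tmc_ge_missing[OF G con, of b a] M N assms by (auto simp: insert_commute)
  \<comment> \<open>The number \<open>d\<close> of repetitions in an optimal coloring is at most 3
    by the star bound. This makes the upper bound on tmc applicable, which yields
    \<open>3 \<le> d\<close>.\<close>
  moreover obtain d where d: "tmc G + d = card (verts G) + card (edges G)"
    using tmc_le_card_elements[OF G con] assms le_iff_add by metis
  ultimately show ?L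
    using card_Union_missing_le[OF G con, of d] N3 assms by simp
qed

theorem theorem8:
  fixes G :: "'a ugraph" and n m :: nat
  assumes "simple_graph G"
    and "connected_graph G"
    and "card (verts G) = n"
    and "card (edges G) = m"
  shows "int (tmc G) = int m + int n - 3 \<longleftrightarrow>
    is_complete_minus G n (complete_graph 3) \<or> is_complete_minus G n (path_graph 3)"
proof -
  \<comment> \<open>Moving the 3 to the other side allows natural numbers without truncated
    subtraction.\<close>
  have "int (tmc G) = int m + int n - 3 \<longleftrightarrow> tmc G + 3 = card (verts G) + card (edges G)"
    using assms(3,4) by linarith
  then show ?thesis
    unfolding tmc_add_3_eq_iff[OF assms(1,2)]
      is_complete_minus_path_graph_3_iff[OF assms(1,3)]
      is_complete_minus_complete_graph_3_iff[OF assms(1,3)]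
    by (simp only: conj_disj_distribL ex_disj_distrib)
qed

end
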